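(* An arithmetic function $f: \mathbf{N} \rightarrow \mathbf{N}_0$ is the fixed point counting function of a permutation of finite type and finite multiplicity if and only if, for all $\ell \in \mathbf{N}$, \[ \sum_{\substack{k=1 \\ k \mid \ell}}^{\ell} \mu\left(\frac{\ell}{k}\right) f(k) \geq 0 \] and \[ \sum_{\substack{k=1 \\ k \mid \ell}}^{\ell} \mu\left(\frac{\ell}{k}\right) f(k) \equiv 0 \pmod{\ell}. \]
   Context: $\mathbf{N} = \{1,2,3,\ldots\}$ and $\mathbf{N}_0 = \mathbf{N} \cup \{0\}$. An arithmetic function is a function whose domain is $\mathbf{N}$. $\mu$ is the Möbius function: $\mu(1) = 1$, $\mu(k) = (-1)^r$ if $k$ is the product of $r$ distinct primes, and $\mu(k) = 0$ if $k$ is divisible by $p^2$ for some prime $p$. Permutations are permutations of a nonempty finite or countably infinite set $X$, and $\mathrm{Perm}(X)$ is the group of permutations of $X$. Every $\sigma \in \mathrm{Perm}(X)$ has a unique decomposition as a product of pairwise disjoint cycles of finite length (fixed points being cycles of length $1$) or infinite length. $\sigma$ is of finite type if its decomposition contains no cycle of infinite length. $\sigma$ has finite multiplicity if, for every $\ell \in \mathbf{N}$, its decomposition contains only finitely many cycles of length $\ell$. For $k \in \mathbf{N}$, $F_X(\sigma^k)$ is the number of $x \in X$ with $\sigma^k(x) = x$; the arithmetic function $k \mapsto F_X(\sigma^k)$ is the fixed point counting function of $\sigma$.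
   Formalization: The function f is assumed not identically zero: for f = 0 both conditions hold, but a permutation of finite type of a nonempty set X has a cycle of some finite length ℓ, so its fixed point counting function is positive at ℓ. *)

theory Defs
  imports
    "HOL-Combinatorics.Combinatorics"
    "HOL-Number_Theory.Number_Theory"
    "HOL-Library.Countable_Set"
    "HOL-Library.Infinite_Typeclass"
begin

definition moebius_mu :: "nat \<Rightarrow> int" where
  "moebius_mu n =
     (if \<exists>p. prime p \<and> p ^ 2 dvd n then 0 else (- 1) ^ card (prime_factors n))"

(* The underlying set of the cycle through x, i.e. the two-sided orbit of x. The library constant
   orbit only collects forward iterates, so it does not give the infinite cycles. *)
definition cycle_through :: "('a \<Rightarrow> 'a) \<Rightarrow> 'a \<Rightarrow> 'a set" where
  "cycle_through \<sigma> x = {y. \<exists>n. (\<sigma> ^^ n) x = y \<or> (\<sigma> ^^ n) y = x}"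

(* Each cycle of the decomposition of a permutation of X is represented by its underlying set, so
   that distinct fixed points give distinct cycles of length 1; the length of a cycle is the
   cardinality of this set. The carrier X matters because permutes makes every point outside X
   a fixed point. *)
definition cycles_of :: "'a set \<Rightarrow> ('a \<Rightarrow> 'a) \<Rightarrow> 'a set set" where
  "cycles_of X \<sigma> = cycle_through \<sigma> ` X"

definition finite_type :: "'a set \<Rightarrow> ('a \<Rightarrow> 'a) \<Rightarrow> bool" where
  "finite_type X \<sigma> \<longleftrightarrow> (\<forall>C \<in> cycles_of X \<sigma>. finite C)"

definition finite_multiplicity :: "'a set \<Rightarrow> ('a \<Rightarrow> 'a) \<Rightarrow> bool" where
  "finite_multiplicity X \<sigma> \<longleftrightarrow>
     (\<forall>l\<ge>1. finite {C \<in> cycles_of X \<sigma>. finite C \<and> card C = l})"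

(* Finiteness is stated separately because card is 0 on infinite sets. Arithmetic functions have
   domain {1, 2, ...}, so the value f 0 is never used. *)
definition fixed_point_counting_function ::
    "'a set \<Rightarrow> ('a \<Rightarrow> 'a) \<Rightarrow> (nat \<Rightarrow> nat) \<Rightarrow> bool" where
  "fixed_point_counting_function X \<sigma> f \<longleftrightarrow>
     (\<forall>k\<ge>1. finite {x \<in> X. (\<sigma> ^^ k) x = x} \<and> card {x \<in> X. (\<sigma> ^^ k) x = x} = f k)"

lemma cycle_through_eq:
  assumes "\<sigma> permutes X" and "y \<in> cycle_through \<sigma> x"
  shows "cycle_through \<sigma> y = cycle_through \<sigma> x"
proof -
  have inj: "(\<sigma> ^^ n) a = (\<sigma> ^^ n) b \<longleftrightarrow> a = b" for n a b
    using permutes_inj[OF assms(1)] by (metis inj_fn injD)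
  have trans: "c \<in> cycle_through \<sigma> a"
    if b: "b \<in> cycle_through \<sigma> a" and c: "c \<in> cycle_through \<sigma> b" for a b c
  proof -
    have cancel: "\<exists>n. (\<sigma> ^^ n) u = v \<or> (\<sigma> ^^ n) v = u"
      if "(\<sigma> ^^ i) u = (\<sigma> ^^ j) v" for i j u v
    proof (cases "i \<le> j")
      case True
      then have "(\<sigma> ^^ i) u = (\<sigma> ^^ i) ((\<sigma> ^^ (j - i)) v)"
        using that by (metis comp_apply funpow_add le_add_diff_inverse)
      then show ?thesis using inj by metis
    next
      case False
      then have "(\<sigma> ^^ j) v = (\<sigma> ^^ j) ((\<sigma> ^^ (i - j)) u)"
        using that by (metis comp_apply funpow_add le_add_diff_inverse nat_le_linear)
      then show ?thesis using inj by metis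
    qed
    obtain i where i: "(\<sigma> ^^ i) a = b \<or> (\<sigma> ^^ i) b = a"
      using b unfolding cycle_through_def by blast
    obtain j where j: "(\<sigma> ^^ j) b = c \<or> (\<sigma> ^^ j) c = b"
      using c unfolding cycle_through_def by blast
    have swap: "(\<sigma> ^^ i) ((\<sigma> ^^ j) z) = (\<sigma> ^^ j) ((\<sigma> ^^ i) z)" for z
      by (metis add.commute comp_apply funpow_add)
    have "\<exists>m n. (\<sigma> ^^ m) a = (\<sigma> ^^ n) c"
    proof -
      have "(\<sigma> ^^ (j + i)) a = (\<sigma> ^^ 0) c \<or> (\<sigma> ^^ i) a = (\<sigma> ^^ j) c \<or>
            (\<sigma> ^^ j) a = (\<sigma> ^^ i) c \<or> (\<sigma> ^^ 0) a = (\<sigma> ^^ (i + j)) c"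
        using i j swap[of b] by (auto simp: funpow_add)
      then show ?thesis by blast
    qed
    then show ?thesis using cancel by (auto simp: cycle_through_def)
  qed
  have "x \<in> cycle_through \<sigma> y"
    using assms(2) by (auto simp: cycle_through_def)
  then show ?thesis using trans assms(2) by blast
qed

lemma partition_on_cycles_of:
  assumes "\<sigma> permutes X"
  shows "partition_on X (cycles_of X \<sigma>)"
proof (rule partition_onI)
  have self: "x \<in> cycle_through \<sigma> x" for x
    by (auto simp: cycle_through_def intro: exI[of _ 0])
  have in_X: "(\<sigma> ^^ n) x \<in> X \<longleftrightarrow> x \<in> X" for n x
    by (induction n) (auto simp: permutes_in_image[OF assms])
  show "\<Union> (cycles_of X \<sigma>) = X"
  proof
    show "\<Union> (cycles_of X \<sigma>) \<subseteq> X"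
      unfolding cycles_of_def cycle_through_def using in_X by blast
    show "X \<subseteq> \<Union> (cycles_of X \<sigma>)"
      unfolding cycles_of_def using self by blast
  qed
  show "{} \<notin> cycles_of X \<sigma>"
    using self by (force simp: cycles_of_def)
  show "disjnt p q" if "p \<in> cycles_of X \<sigma>" "q \<in> cycles_of X \<sigma>" "p \<noteq> q" for p q
  proof (rule ccontr)
    assume "\<not> disjnt p q"
    then obtain z where "z \<in> p" "z \<in> q" by (auto simp: disjnt_def)
    then have "p = cycle_through \<sigma> z" "q = cycle_through \<sigma> z"
      using that cycle_through_eq[OF assms] by (auto simp: cycles_of_def)
    then show False using that(3) by simp
  qed
qed

end

theory Submission imports Defs "HOL-Computational_Algebra.Squarefree" begin

text \<open>
  If \<open>m d\<close> is the number of cycles of length \<open>d\<close>, then \<open>x\<close> is fixed by the \<open>k\<close>-th power iff the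
  length of its cycle divides \<open>k\<close>, so \<open>f k\<close> is the sum of \<open>d * m d\<close> over the divisors \<open>d\<close> of \<open>k\<close>.
  By Moebius inversion this says that the Moebius transform of \<open>f\<close> at \<open>l\<close> is \<open>l * m l\<close>. Conversely,
  if the transform is nonnegative and divisible by \<open>l\<close>, one takes a disjoint union of cycles, with
  \<open>m l\<close> of them of length \<open>l\<close>.
\<close>

subsection \<open>Moebius inversion\<close>

text \<open>The square of a non-unit dividing a positive number brings a prime square with it, so
  the test in \<open>moebius_mu\<close> agrees with the general notion \<open>squarefree\<close>.
  Zero falls on the same side, since 4 divides it.\<close>

lemma moebius_mu_not_squarefree:
  assumes "\<not> squarefree n"
  shows "moebius_mu n = 0"
proof (cases "n = 0")
  case True
  then have "prime (2::nat) \<and> 2 ^ 2 dvd n" by simp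
  then have "\<exists>p. prime p \<and> p ^ 2 dvd n" by blast
  then show ?thesis unfolding moebius_mu_def by simp
next
  case False
  then obtain x where x: "x ^ 2 dvd n" "\<not> is_unit x"
    using assms by (auto simp: squarefree_def)
  then have "x \<noteq> 0" using False by auto
  then obtain p where p: "prime p" "p dvd x"
    using x(2) prime_divisor_exists by blast
  then have "p ^ 2 dvd n"
    using x(1) dvd_power_same dvd_trans by blast
  then show ?thesis
    using p(1) unfolding moebius_mu_def by auto
qed

lemma moebius_mu_squarefree:
  assumes "squarefree n"
  shows "moebius_mu n = (-1) ^ card (prime_factors n)"
proof -
  have "\<not> (\<exists>p. prime p \<and> p ^ 2 dvd n)"
    using assms squarefreeD not_prime_unit by blast
  then show ?thesis unfolding moebius_mu_def by simp
qed

text \<open>The set of prime factors gains exactly \<open>p\<close>, which flips the sign. This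
  produces the cancelling pairs in the divisor sum.\<close>

lemma moebius_mu_prime_mult:
  assumes "prime p" and "squarefree d" and "\<not> p dvd d"
  shows "squarefree (p * d)" and "moebius_mu (p * d) = - moebius_mu d"
proof -
  have cop: "coprime p d" using assms(1,3) by (rule prime_imp_coprime)
  show sq: "squarefree (p * d)"
    using cop assms(1,2) by (simp add: squarefree_mult_coprime squarefree_prime)
  have "d \<noteq> 0" using assms(3) by (metis dvd_0_right)
  moreover have "p \<noteq> 0" using assms(1) by auto
  ultimately have "prime_factors (p * d) = insert p (prime_factors d)"
    using assms(1) by (simp add: prime_factors_product prime_prime_factors)
  moreover have "p \<notin> prime_factors d" using assms(3) by auto
  ultimately show "moebius_mu (p * d) = - moebius_mu d"
    by (simp add: moebius_mu_squarefree[OF sq] moebius_mu_squarefree[OF assms(2)])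
qed

text \<open>For \<open>n \<noteq> 1\<close> fix a prime \<open>p\<close> dividing \<open>n\<close>.
  Only squarefree divisors contribute, and multiplication by \<open>p\<close> maps those not
  divisible by \<open>p\<close> bijectively onto those divisible by \<open>p\<close>, with opposite
  sign.\<close>

lemma sum_moebius_mu_divisors:
  assumes "n > 0"
  shows "(\<Sum>d | d dvd n. moebius_mu d) = (if n = 1 then 1 else 0)"
proof (cases "n = 1")
  case True
  have "moebius_mu 1 = 1" by (simp add: moebius_mu_squarefree)
  then show ?thesis using True by simp
next
  case False
  then obtain p where p: "prime p" "p dvd n"
    using prime_factor_nat by blast
  have p0: "p > 0" using p(1) by (simp add: prime_gt_0_nat)
  define A where "A = {d. d dvd n \<and> squarefree d \<and> \<not> p dvd d}"
  define B where "B = {d. d dvd n \<and> squarefree d \<and> p dvd d}"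
  have fin: "finite {d. d dvd n}" using assms by (rule finite_divisors_nat)
  have finAB: "finite A" "finite B"
    using fin by (auto simp: A_def B_def intro: finite_subset)
  have "(\<Sum>d | d dvd n. moebius_mu d) = (\<Sum>d\<in>A \<union> B. moebius_mu d)"
    using fin by (intro sum.mono_neutral_right)
      (auto simp: A_def B_def intro: ccontr dest: moebius_mu_not_squarefree)
  also have "\<dots> = (\<Sum>d\<in>A. moebius_mu d) + (\<Sum>d\<in>B. moebius_mu d)"
    using finAB by (intro sum.union_disjoint) (auto simp: A_def B_def)
  also have "B = (*) p ` A"
  proof (intro equalityI subsetI)
    fix d assume d: "d \<in> B"
    then obtain e where e: "d = p * e" unfolding B_def by blast
    have "squarefree e" using d e squarefree_mono[of e d] by (auto simp: B_def)
    moreover have "\<not> p dvd e"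
    proof
      assume "p dvd e"
      then have "p ^ 2 dvd d" using e by (simp add: power2_eq_square)
      then have "is_unit p" using d squarefreeD unfolding B_def by blast
      then show False using p(1) by auto
    qed
    moreover have "e dvd n" using d e by (auto simp: B_def intro: dvd_mult_right)
    ultimately show "d \<in> (*) p ` A" using e by (auto simp: A_def)
  next
    fix d assume "d \<in> (*) p ` A"
    then obtain e where e: "d = p * e" "e dvd n" "squarefree e" "\<not> p dvd e"
      by (auto simp: A_def)
    have "p * e dvd n"
      using e p by (intro divides_mult prime_imp_coprime) auto
    then show "d \<in> B"
      using moebius_mu_prime_mult(1)[OF p(1) e(3,4)] e(1) by (auto simp: B_def)
  qed
  also have "(\<Sum>d\<in>(*) p ` A. moebius_mu d) = (\<Sum>d\<in>A. moebius_mu (p * d))"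
    using p0 by (subst sum.reindex) (auto simp: inj_on_def)
  also have "\<dots> = - (\<Sum>d\<in>A. moebius_mu d)"
    unfolding sum_negf[symmetric]
    by (intro sum.cong) (auto simp: A_def moebius_mu_prime_mult(2)[OF p(1)])
  finally show ?thesis using False by simp
qed

section \<open>The two inversion formulas\<close>

text \<open>With \<open>l = d * e\<close>, sending \<open>k\<close> to \<open>l div k\<close>
  identifies the summation range with the divisors of \<open>e\<close>, which reduces the claim to
  the full divisor sum. The value is the coefficient of \<open>g d\<close> in the first inversion
  formula.\<close>

lemma sum_moebius_mu_upper:
  assumes "d dvd l" "l > 0"
  shows "(\<Sum>k | d dvd k \<and> k dvd l. moebius_mu (l div k)) = (if d = l then 1 else 0)"
proof -
  obtain e where e: "l = d * e" using assms(1) by blast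
  then have pos: "d > 0" "e > 0" using assms(2) by auto
  have "(\<Sum>k | d dvd k \<and> k dvd l. moebius_mu (l div k)) = (\<Sum>c | c dvd e. moebius_mu c)"
    using pos e
    by (intro sum.reindex_bij_witness[of _ "\<lambda>c. d * (e div c)" "\<lambda>k. l div k"])
       (auto elim!: dvdE simp: mult.assoc)
  also have "\<dots> = (if d = l then 1 else 0)"
    using pos e by (simp add: sum_moebius_mu_divisors)
  finally show ?thesis .
qed

lemma sum_moebius_mu_lower:
  assumes "k dvd n" "n > 0"
  shows "(\<Sum>d | k dvd d \<and> d dvd n. moebius_mu (d div k)) = (if k = n then 1 else 0)"
proof -
  obtain e where e: "n = k * e" using assms(1) by blast
  then have pos: "k > 0" "e > 0" using assms(2) by auto
  have "(\<Sum>d | k dvd d \<and> d dvd n. moebius_mu (d div k)) = (\<Sum>c | c dvd e. moebius_mu c)"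
    using pos e
    by (intro sum.reindex_bij_witness[of _ "\<lambda>c. k * c" "\<lambda>d. d div k"])
       (auto elim!: dvdE simp: mult.assoc)
  also have "\<dots> = (if k = n then 1 else 0)"
    using pos e by (simp add: sum_moebius_mu_divisors)
  finally show ?thesis .
qed

lemma sum_divisors_swap:
  fixes h :: "nat \<Rightarrow> nat \<Rightarrow> int"
  assumes "l > 0"
  shows "(\<Sum>k | k dvd l. \<Sum>d | d dvd k. h k d) = (\<Sum>d | d dvd l. \<Sum>k | d dvd k \<and> k dvd l. h k d)"
proof -
  have fin: "finite {d. d dvd l}" using assms by (rule finite_divisors_nat)
  \<comment> \<open>Adding \<open>d dvd l\<close>, which follows by transitivity, lets both indices
    range over the same finite set before the swap.\<close>
  have "(\<Sum>k | k dvd l. \<Sum>d | d dvd k. h k d) = (\<Sum>k | k dvd l. \<Sum>d | d dvd l \<and> d dvd k. h k d)"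
    by (intro sum.cong) (auto intro: dvd_trans)
  also have "\<dots> = (\<Sum>d | d dvd l. \<Sum>k | k dvd l \<and> d dvd k. h k d)"
    using sum.swap_restrict[OF fin fin, of h "\<lambda>k d. d dvd k"] by simp
  also have "\<dots> = (\<Sum>d | d dvd l. \<Sum>k | d dvd k \<and> k dvd l. h k d)"
    by (simp add: conj_commute)
  finally show ?thesis .
qed

text \<open>Once the sums are interchanged, only the term \<open>d = l\<close> survives. This
  direction reads the cycle counts off the fixed point counts.\<close>

lemma moebius_inversion1:
  fixes f g :: "nat \<Rightarrow> int"
  assumes "\<And>k. k > 0 \<Longrightarrow> f k = (\<Sum>d | d dvd k. g d)" "l > 0"
  shows "(\<Sum>k | k dvd l. moebius_mu (l div k) * f k) = g l"
proof -
  have "(\<Sum>k | k dvd l. moebius_mu (l div k) * f k)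
      = (\<Sum>k | k dvd l. \<Sum>d | d dvd k. moebius_mu (l div k) * g d)"
    using assms by (intro sum.cong) (auto simp: sum_distrib_left dvd_pos_nat)
  also have "\<dots> = (\<Sum>d | d dvd l. (\<Sum>k | d dvd k \<and> k dvd l. moebius_mu (l div k)) * g d)"
    using assms(2) by (simp add: sum_divisors_swap sum_distrib_right)
  also have "\<dots> = (\<Sum>d | d dvd l. if d = l then g d else 0)"
    using assms(2) by (intro sum.cong) (auto simp: sum_moebius_mu_upper)
  also have "\<dots> = g l"
    using assms(2) by (simp add: finite_divisors_nat)
  finally show ?thesis .
qed

text \<open>The same interchange, with the transform now inside. This direction recovers
  \<open>f\<close> from the cycle counts of the constructed permutation.\<close>

lemma moebius_inversion2:
  fixes f g :: "nat \<Rightarrow> int"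
  assumes "\<And>l. l > 0 \<Longrightarrow> g l = (\<Sum>k | k dvd l. moebius_mu (l div k) * f k)" "n > 0"
  shows "f n = (\<Sum>d | d dvd n. g d)"
proof -
  have "(\<Sum>d | d dvd n. g d) = (\<Sum>d | d dvd n. \<Sum>k | k dvd d. moebius_mu (d div k) * f k)"
    using assms by (intro sum.cong) (auto simp: dvd_pos_nat)
  also have "\<dots> = (\<Sum>k | k dvd n. (\<Sum>d | k dvd d \<and> d dvd n. moebius_mu (d div k)) * f k)"
    using assms(2) by (simp add: sum_divisors_swap sum_distrib_right)
  also have "\<dots> = (\<Sum>k | k dvd n. if k = n then f k else 0)"
    using assms(2) by (intro sum.cong) (auto simp: sum_moebius_mu_lower)
  also have "\<dots> = f n"
    using assms(2) by (simp add: finite_divisors_nat)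
  finally show ?thesis ..
qed

subsection \<open>Counting fixed points by cycle length\<close>

text \<open>\<open>cycle_through\<close> also admits backward iterates; a period turns each of them
  into a forward one, and exponents can then be reduced modulo \<open>n\<close>. Any positive period
  will do, so the listing may repeat points.\<close>

lemma cycle_through_periodic:
  assumes "inj \<sigma>" and "(\<sigma> ^^ n) x = x" and "n > 0"
  shows "cycle_through \<sigma> x = (\<lambda>i. (\<sigma> ^^ i) x) ` {..<n}"
proof (intro equalityI subsetI)
  fix y assume "y \<in> cycle_through \<sigma> x"
  then obtain i where i: "(\<sigma> ^^ i) x = y \<or> (\<sigma> ^^ i) y = x"
    by (auto simp: cycle_through_def)
  have "\<exists>i. (\<sigma> ^^ i) x = y"
  proof (cases "(\<sigma> ^^ i) x = y")
    case False
    \<comment> \<open>Going back \<open>i\<close> steps amounts to going forward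
      \<open>i * (n - 1)\<close> steps, since both differ by \<open>i\<close> full periods.\<close>
    have "(\<sigma> ^^ (i * n)) x = x"
      using funpow_mod_eq[OF assms(2), of "i * n"] by simp
    moreover have "i * n = i + i * (n - 1)"
      using assms(3) by (cases n) auto
    ultimately have "(\<sigma> ^^ i) ((\<sigma> ^^ (i * (n - 1))) x) = (\<sigma> ^^ i) y"
      using i False by (simp add: funpow_add)
    then have "(\<sigma> ^^ (i * (n - 1))) x = y"
      using assms(1) by (metis inj_fn injD)
    then show ?thesis by blast
  qed blast
  then obtain j where "(\<sigma> ^^ j) x = y" by blast
  then have "(\<sigma> ^^ (j mod n)) x = y"
    using funpow_mod_eq[OF assms(2)] by metis
  then show "y \<in> (\<lambda>i. (\<sigma> ^^ i) x) ` {..<n}"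
    using assms(3) by (intro image_eqI[of _ _ "j mod n"]) auto
qed (auto simp: cycle_through_def)

text \<open>A finite cycle forces a repetition among the forward iterates, and injectivity moves it
  back to \<open>x\<close>. The least positive period equals the length of the cycle, and exponents
  act modulo this period.\<close>

lemma funpow_fixed_iff_card_cycle_dvd:
  assumes "inj \<sigma>" and "finite (cycle_through \<sigma> x)"
  shows "(\<sigma> ^^ k) x = x \<longleftrightarrow> card (cycle_through \<sigma> x) dvd k"
proof -
  have cancel: "(\<sigma> ^^ (j - i)) x = x" if "(\<sigma> ^^ i) x = (\<sigma> ^^ j) x" "i < j" for i j
  proof -
    have "(\<sigma> ^^ i) ((\<sigma> ^^ (j - i)) x) = (\<sigma> ^^ i) x"
      using that by (metis comp_apply funpow_add le_add_diff_inverse less_imp_le)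
    then show ?thesis using assms(1) by (metis inj_fn injD)
  qed
  have "range (\<lambda>i. (\<sigma> ^^ i) x) \<subseteq> cycle_through \<sigma> x"
    by (auto simp: cycle_through_def)
  then have "finite (range (\<lambda>i. (\<sigma> ^^ i) x))"
    using assms(2) finite_subset by blast
  then have "\<not> inj (\<lambda>i. (\<sigma> ^^ i) x)"
    using finite_imageD infinite_UNIV_nat by blast
  then obtain i j where "i < j" "(\<sigma> ^^ i) x = (\<sigma> ^^ j) x"
    unfolding inj_def by (metis linorder_neqE_nat)
  then have ex: "\<exists>n. n > 0 \<and> (\<sigma> ^^ n) x = x"
    using cancel by (metis zero_less_diff)
  define d where "d = (LEAST n. n > 0 \<and> (\<sigma> ^^ n) x = x)"
  have d: "d > 0" "(\<sigma> ^^ d) x = x"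
    using LeastI_ex[OF ex] by (auto simp: d_def)
  have least: "(\<sigma> ^^ n) x \<noteq> x" if "0 < n" "n < d" for n
    using not_less_Least[of n "\<lambda>n. n > 0 \<and> (\<sigma> ^^ n) x = x"] that by (auto simp: d_def)
  \<comment> \<open>Minimality of \<open>d\<close> rules out repetitions, so the periodic listing
    has exactly \<open>d\<close> points.\<close>
  have "inj_on (\<lambda>i. (\<sigma> ^^ i) x) {..<d}"
  proof (rule linorder_inj_onI)
    fix i j assume "i < j" "j \<in> {..<d}"
    then show "(\<sigma> ^^ i) x \<noteq> (\<sigma> ^^ j) x"
      using cancel[of i j] least[of "j - i"] by auto
  qed auto
  then have card: "card (cycle_through \<sigma> x) = d"
    by (simp add: cycle_through_periodic[OF assms(1) d(2,1)] card_image)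
  have "(\<sigma> ^^ k) x = (\<sigma> ^^ (k mod d)) x"
    using funpow_mod_eq[OF d(2)] by metis
  then have "(\<sigma> ^^ k) x = x \<longleftrightarrow> k mod d = 0"
    using least[of "k mod d"] d(1) by (cases "k mod d = 0") auto
  then show ?thesis by (simp add: card dvd_eq_mod_eq_0)
qed

text \<open>The fixed points of the \<open>k\<close>-th power fill exactly the cycles whose length
  divides \<open>k\<close>. A positive \<open>k\<close> has finitely many divisors, each length
  occurs finitely often and each cycle is finite, so the points can be counted by cycle
  length.\<close>

lemma card_fixed_points:
  assumes "\<sigma> permutes X" "finite_type X \<sigma>" "finite_multiplicity X \<sigma>" "k > 0"
  shows "finite {x \<in> X. (\<sigma> ^^ k) x = x}"
    and "card {x \<in> X. (\<sigma> ^^ k) x = x} = (\<Sum>d | d dvd k. d * card {C \<in> cycles_of X \<sigma>. card C = d})"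
proof -
  define Cy where "Cy d = {C \<in> cycles_of X \<sigma>. card C = d}" for d
  have fin: "finite C" if "C \<in> cycles_of X \<sigma>" for C
    using assms(2) that by (auto simp: finite_type_def)
  note part = partition_on_cycles_of[OF assms(1)]
  have finCy: "finite (Cy d)" if "d dvd k" for d
  proof -
    \<comment> \<open>Finite multiplicity speaks of positive lengths only.\<close>
    have "d \<ge> 1" using that assms(4) by (auto simp: dvd_pos_nat Suc_le_eq)
    moreover have "Cy d = {C \<in> cycles_of X \<sigma>. finite C \<and> card C = d}"
      using fin by (auto simp: Cy_def)
    ultimately show ?thesis using assms(3) by (auto simp: finite_multiplicity_def)
  qed
  have findiv: "finite {d. d dvd k}" using assms(4) by (rule finite_divisors_nat)
  define D where "D = (\<Union>d\<in>{d. d dvd k}. Cy d)"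
  have D_sub: "D \<subseteq> cycles_of X \<sigma>" by (auto simp: D_def Cy_def)
  have finD: "finite D" using findiv finCy by (auto simp: D_def)
  have eq: "{x \<in> X. (\<sigma> ^^ k) x = x} = \<Union> D"
  proof -
    have mem: "x \<in> C \<Longrightarrow> C \<in> cycles_of X \<sigma> \<Longrightarrow> C = cycle_through \<sigma> x" for x C
      using cycle_through_eq[OF assms(1)] by (auto simp: cycles_of_def)
    have fixed: "(\<sigma> ^^ k) x = x \<longleftrightarrow> card (cycle_through \<sigma> x) dvd k" if "x \<in> X" for x
      using funpow_fixed_iff_card_cycle_dvd[OF permutes_inj[OF assms(1)]] fin that
      by (auto simp: cycles_of_def)
    have X: "\<Union> (cycles_of X \<sigma>) = X" using part by (simp add: partition_on_def)
    show ?thesis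
    proof (intro equalityI subsetI)
      fix x assume x: "x \<in> {x \<in> X. (\<sigma> ^^ k) x = x}"
      then obtain C where C: "x \<in> C" "C \<in> cycles_of X \<sigma>" using X by blast
      then have "C \<in> D" using mem[OF C] x fixed by (auto simp: D_def Cy_def)
      then show "x \<in> \<Union> D" using C by blast
    next
      fix x assume "x \<in> \<Union> D"
      then obtain C where C: "x \<in> C" "C \<in> cycles_of X \<sigma>" "card C dvd k"
        by (auto simp: D_def Cy_def)
      then have "x \<in> X" using X by blast
      then show "x \<in> {x \<in> X. (\<sigma> ^^ k) x = x}" using mem[OF C(1,2)] C(3) fixed by auto
    qed
  qed
  show "finite {x \<in> X. (\<sigma> ^^ k) x = x}"
    unfolding eq using finD D_sub fin by blast
  have "card (\<Union> D) = (\<Sum>C\<in>D. card C)"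
    using D_sub fin part by (intro card_Union_disjoint)
      (auto simp: partition_on_def intro: pairwise_subset[of disjnt "cycles_of X \<sigma>"]
            dest: disjointD)
  also have "\<dots> = (\<Sum>d | d dvd k. \<Sum>C\<in>Cy d. card C)"
    unfolding D_def using findiv finCy by (intro sum.UNION_disjoint) (auto simp: Cy_def)
  also have "\<dots> = (\<Sum>d | d dvd k. d * card (Cy d))"
    by (intro sum.cong) (auto simp: Cy_def)
  finally show "card {x \<in> X. (\<sigma> ^^ k) x = x} = (\<Sum>d | d dvd k. d * card {C \<in> cycles_of X \<sigma>. card C = d})"
    by (simp add: eq Cy_def)
qed

subsection \<open>Permutations with prescribed cycle lengths\<close>

text \<open>The triple \<open>(l, i, j)\<close> stands for position \<open>j\<close> in the
  \<open>i\<close>-th copy of a cycle of length \<open>l\<close>. Advancing \<open>j\<close> modulo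
  \<open>l\<close> gives the permutation, which is carried into the type \<open>'a\<close> by an
  injection.\<close>

lemma exists_permutation_with_cycle_counts:
  fixes m :: "nat \<Rightarrow> nat"
  obtains X :: "'a::infinite set" and \<sigma>
  where "countable X" "\<sigma> permutes X" "finite_type X \<sigma>" "finite_multiplicity X \<sigma>"
    "\<And>l. l > 0 \<Longrightarrow> card {C \<in> cycles_of X \<sigma>. card C = l} = m l"
proof -
  \<comment> \<open>Every infinite type contains a copy of the natural numbers, which in turn encode
    the triples.\<close>
  obtain e :: "nat \<Rightarrow> 'a" where e: "inj e"
    using infinite_UNIV infinite_countable_subset by blast
  define g :: "nat \<times> nat \<times> nat \<Rightarrow> 'a" where "g = e \<circ> to_nat"
  have g: "inj g" using e by (simp add: g_def inj_compose)
  define Y where "Y = {(l, i, j). i < m l \<and> j < l}"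
  define \<tau> where "\<tau> = (\<lambda>(l, i, j). if i < m l \<and> j < l then (l, i, Suc j mod l) else (l, i, j))"
  have \<tau>: "\<tau> permutes Y"
  proof (rule bij_imp_permutes)
    show "bij_betw \<tau> Y Y"
    \<comment> \<open>The inverse steps back by one position and wraps from 0 to
      \<open>l - 1\<close>.\<close>
    proof (rule bij_betw_byWitness[where f' = "\<lambda>(l, i, j). (l, i, if j = 0 then l - 1 else j - 1)"])
    qed (auto simp: Y_def \<tau>_def mod_Suc split: if_splits)
  qed (auto simp: Y_def \<tau>_def split: if_splits)
  define X where "X = g ` Y"
  have bij: "bij_betw g Y X"
    using g by (auto simp: X_def bij_betw_def inj_on_def)
  define \<sigma> where "\<sigma> = (\<lambda>x. if x \<in> X then g (\<tau> (inv_into Y g x)) else x)"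
  have \<sigma>: "\<sigma> permutes X"
    unfolding \<sigma>_def by (rule permutes_bij_inv_into[OF \<tau> bij])
  have step: "\<sigma> (g (l, i, j)) = g (l, i, Suc j mod l)" if "i < m l" "j < l" for l i j
  proof -
    have "(l, i, j) \<in> Y" using that by (simp add: Y_def)
    then show ?thesis
      using that bij by (auto simp: \<sigma>_def X_def \<tau>_def bij_betw_def)
  qed
  have pow: "(\<sigma> ^^ n) (g (l, i, j)) = g (l, i, (j + n) mod l)" if "i < m l" "j < l" for l i j n
    using that by (induction n) (auto simp: step mod_Suc_eq)
  define Cyc where "Cyc l i = g ` ({l} \<times> {i} \<times> {..<l})" for l i
  have cyc: "cycle_through \<sigma> (g (l, i, j)) = Cyc l i" if "i < m l" "j < l" for l i j
  proof -
    have "(\<sigma> ^^ l) (g (l, i, j)) = g (l, i, j)" using that by (simp add: pow)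
    then have "cycle_through \<sigma> (g (l, i, j)) = (\<lambda>n. g (l, i, (j + n) mod l)) ` {..<l}"
      using that permutes_inj[OF \<sigma>] by (subst cycle_through_periodic) (auto simp: pow)
    also have "\<dots> = g ` ({l} \<times> {i} \<times> {..<l})"
    proof (intro equalityI subsetI)
      fix y assume "y \<in> g ` ({l} \<times> {i} \<times> {..<l})"
      then obtain j' where j': "j' < l" "y = g (l, i, j')" by auto
      show "y \<in> (\<lambda>n. g (l, i, (j + n) mod l)) ` {..<l}"
      proof (cases "j \<le> j'")
        case True
        then show ?thesis using j' by (intro image_eqI[of _ _ "j' - j"]) auto
      next
        case False
        \<comment> \<open>The target position lies behind \<open>j\<close>, so the path wraps around
          once.\<close>
        then show ?thesis using j' that
          by (intro image_eqI[of _ _ "j' + l - j"]) auto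
      qed
    qed (use that in auto)
    finally show ?thesis by (simp add: Cyc_def)
  qed
  have card_Cyc: "card (Cyc l i) = l" for l i
  proof -
    have "inj_on g ({l} \<times> {i} \<times> {..<l})" using g by (auto simp: inj_on_def)
    then show ?thesis by (simp add: Cyc_def card_image card_cartesian_product)
  qed
  \<comment> \<open>The condition \<open>0 < l\<close> keeps out the sets \<open>Cyc 0 i\<close>,
    which are empty and hence no cycles.\<close>
  have cycles: "cycles_of X \<sigma> = {Cyc l i | l i. i < m l \<and> 0 < l}"
  proof (intro equalityI subsetI)
    fix C assume "C \<in> cycles_of X \<sigma>"
    then show "C \<in> {Cyc l i | l i. i < m l \<and> 0 < l}"
      by (force simp: cycles_of_def X_def Y_def cyc)
  next
    fix C assume "C \<in> {Cyc l i | l i. i < m l \<and> 0 < l}"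
    then obtain l i where li: "i < m l" "0 < l" "C = Cyc l i" by blast
    then have "C = cycle_through \<sigma> (g (l, i, 0))" "g (l, i, 0) \<in> X"
      by (auto simp: cyc X_def Y_def)
    then show "C \<in> cycles_of X \<sigma>" by (auto simp: cycles_of_def)
  qed
  have of_card: "{C \<in> cycles_of X \<sigma>. card C = l} = Cyc l ` {..<m l}" if "l > 0" for l
    using that by (auto simp: cycles card_Cyc)
  \<comment> \<open>Position 0 of copy \<open>i\<close> lies in no other copy; for
    \<open>l = 0\<close> all copies would coincide.\<close>
  have "inj_on (Cyc l) {..<m l}" if "l > 0" for l
  proof (rule inj_onI)
    fix i i' assume "Cyc l i = Cyc l i'"
    moreover have "g (l, i, 0) \<in> Cyc l i" using that by (auto simp: Cyc_def)
    ultimately have "g (l, i, 0) \<in> Cyc l i'" by simp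
    then show "i = i'" using g by (auto simp: Cyc_def dest: injD)
  qed
  then have "card {C \<in> cycles_of X \<sigma>. card C = l} = m l" if "l > 0" for l
    using that by (simp add: of_card card_image)
  moreover have "finite_type X \<sigma>"
    by (auto simp: finite_type_def cycles Cyc_def)
  moreover have "finite_multiplicity X \<sigma>"
    unfolding finite_multiplicity_def
  proof (intro allI impI)
    fix l :: nat assume "1 \<le> l"
    then have "finite {C \<in> cycles_of X \<sigma>. card C = l}" by (simp add: of_card)
    then show "finite {C \<in> cycles_of X \<sigma>. finite C \<and> card C = l}"
      by (rule rev_finite_subset) auto
  qed
  moreover have "countable X" by (simp add: X_def)
  ultimately show thesis using \<sigma> that by blast
qed

section \<open>Characterisation of fixed point counting functions\<close>

text \<open>The assumption on \<open>f\<close> excludes the zero function: it meets both divisor sum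
  conditions but counts fixed points only on the empty set, because a point on a cycle of length
  \<open>d\<close> is fixed by the \<open>d\<close>-th power.\<close>

theorem theorem3:
  fixes f :: "nat \<Rightarrow> nat"
  assumes "\<exists>k\<ge>1. f k \<noteq> 0"
  shows "(\<exists>(X :: 'a::infinite set) \<sigma>.
            X \<noteq> {} \<and> countable X \<and> \<sigma> permutes X \<and>
            finite_type X \<sigma> \<and> finite_multiplicity X \<sigma> \<and>
            fixed_point_counting_function X \<sigma> f)
         \<longleftrightarrow>
         (\<forall>l::nat. l \<ge> 1 \<longrightarrow>
            (\<Sum>k | k \<in> {1..l} \<and> k dvd l. moebius_mu (l div k) * int (f k)) \<ge> 0 \<and>
            [(\<Sum>k | k \<in> {1..l} \<and> k dvd l. moebius_mu (l div k) * int (f k)) = 0] (mod (int l)))"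
    (is "?perm \<longleftrightarrow> (\<forall>l. l \<ge> 1 \<longrightarrow> ?S l \<ge> 0 \<and> [?S l = 0] (mod (int l)))")
proof -
  have S: "?S l = (\<Sum>k | k dvd l. moebius_mu (l div k) * int (f k))" if "l > 0" for l
    using that by (intro sum.cong) (auto simp: dvd_imp_le Suc_le_eq dvd_pos_nat)
  show ?thesis
  proof
    assume ?perm
    then obtain X :: "'a set" and \<sigma> where X: "\<sigma> permutes X" "finite_type X \<sigma>"
      "finite_multiplicity X \<sigma>" "fixed_point_counting_function X \<sigma> f"
      by blast
    define m where "m d = card {C \<in> cycles_of X \<sigma>. card C = d}" for d
    have "int (f k) = (\<Sum>d | d dvd k. int (d * m d))" if "k > 0" for k
      using card_fixed_points(2)[OF X(1-3) that] X(4) that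
      by (simp add: fixed_point_counting_function_def m_def Suc_le_eq)
    then have "?S l = int (l * m l)" if "l > 0" for l
      using that by (simp only: S moebius_inversion1)
    then show "\<forall>l. l \<ge> 1 \<longrightarrow> ?S l \<ge> 0 \<and> [?S l = 0] (mod (int l))"
      by (simp add: cong_0_iff Suc_le_eq)
  next
    assume *: "\<forall>l. l \<ge> 1 \<longrightarrow> ?S l \<ge> 0 \<and> [?S l = 0] (mod (int l))"
    \<comment> \<open>The forward direction forces this choice; nonnegativity and divisibility make
      \<open>nat\<close> and \<open>div\<close> exact for positive \<open>l\<close>.\<close>
    define m where "m l = nat (?S l div int l)" for l
    have m: "int (l * m l) = ?S l" if "l > 0" for l
    proof -
      have "?S l \<ge> 0" "int l dvd ?S l"
        using * that by (simp_all only: cong_0_iff Suc_le_eq One_nat_def)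
      then show ?thesis
        unfolding m_def by (simp add: pos_imp_zdiv_nonneg_iff that)
    qed
    obtain X :: "'a set" and \<sigma> where X: "countable X" "\<sigma> permutes X" "finite_type X \<sigma>"
      "finite_multiplicity X \<sigma>" "\<And>l. l > 0 \<Longrightarrow> card {C \<in> cycles_of X \<sigma>. card C = l} = m l"
      using exists_permutation_with_cycle_counts[of m] by blast
    have fixed: "card {x \<in> X. (\<sigma> ^^ k) x = x} = f k" if "k > 0" for k
    proof -
      have "card {x \<in> X. (\<sigma> ^^ k) x = x} = (\<Sum>d | d dvd k. d * m d)"
        unfolding card_fixed_points(2)[OF X(2-4) that]
        using that by (intro sum.cong) (auto simp: X(5) dvd_pos_nat)
      moreover have "int (f k) = (\<Sum>d | d dvd k. int (d * m d))"
        by (rule moebius_inversion2[OF _ that]) (simp only: m S)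
      ultimately show ?thesis
        by (simp only: of_nat_sum[symmetric] of_nat_eq_iff)
    qed
    then have "fixed_point_counting_function X \<sigma> f"
      using card_fixed_points(1)[OF X(2-4)]
      by (simp add: fixed_point_counting_function_def Suc_le_eq)
    \<comment> \<open>A nonzero value of \<open>f\<close> provides a fixed point of some power,
      hence an element of \<open>X\<close>.\<close>
    moreover have "X \<noteq> {}"
      using assms fixed by (force simp: Suc_le_eq)
    ultimately show ?perm using X by blast
  qed
qed

end
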